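(* Let $a\ge n\ge 1$ (and $a>1$ if $n=1$) and let $\Phi:\mathbb{R}^+\to\mathbb{R}^+$ be a $\mathcal{C}^1$ concave function. Let also $g,W,H:\mathbb{R}^n\to(0,+\infty]$ be Borel functions and let $t\in[0,1]$, $s=1-t$, be such that $$\forall x,y\in\mathbb{R}^n,\qquad H(sx+ty)\le s\,g(x)+t\,W(y)$$ and $\int_{\mathbb{R}^n} W^{-a}=\int_{\mathbb{R}^n} g^{-a}=1$. Then $$\int_{\mathbb{R}^n}\Phi(H)H^{-a}\ \ge\ s\int_{\mathbb{R}^n}\Phi(g)g^{-a}+t\int_{\mathbb{R}^n}\Phi(W)W^{-a}.$$
   Context: All integrals are with respect to Lebesgue measure. $\mathbb{R}^+=[0,\infty)$. Negative powers of $+\infty$ are $0$, and an expression $\Phi(u)u^{-a}$ is taken to be $0$ where $u=+\infty$ (this is its limit as $u\to+\infty$). *)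

theory Defs
  imports "HOL-Analysis.Analysis"
begin

(* C1_differentiable_on uses two-sided derivatives; here the derivative is taken within the
   set, so that on [0,oo) the derivative at 0 is one-sided. *)
definition C1_within :: "real set \<Rightarrow> (real \<Rightarrow> real) \<Rightarrow> bool" where
  "C1_within S f \<longleftrightarrow>
     (\<exists>f'. (\<forall>u\<in>S. (f has_real_derivative f' u) (at u within S)) \<and> continuous_on S f')"

(* u^(-a) for u in (0,oo], a > 0. The value at u = 0 is a dummy (powr gives 0 there). *)
definition neg_powr :: "ennreal \<Rightarrow> real \<Rightarrow> ennreal" where
  "neg_powr u a = (if u = top then 0 else ennreal (enn2real u powr (- a)))"

(* \<Phi>(u) u^(-a) for u in (0,oo], extended by 0 at u = oo. *)
definition weighted_neg_powr :: "(real \<Rightarrow> real) \<Rightarrow> ennreal \<Rightarrow> real \<Rightarrow> ennreal" where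
  "weighted_neg_powr \<Phi> u a =
     (if u = top then 0 else ennreal (\<Phi> (enn2real u)) * neg_powr u a)"

end

theory Submission
  imports Defs "HOL-Probability.Probability"
begin

text \<open>
  In place of the Brenier map the proof uses quantile functions and induction on the dimension.
  On the line, let \<open>U\<close> and \<open>V\<close> be the quantile functions of two probability densities \<open>f\<close> and \<open>h\<close>.
  The image under \<open>s U + t V\<close> of the measure \<open>(s / f (U p) + t / h (V p)) dp\<close> on the unit interval
  is dominated by Lebesgue measure (it suffices to compare both on intervals, so no
  differentiability of \<open>U\<close> and \<open>V\<close> is needed). Hence if
  \<open>k (s x + t y) \<ge> (s \<phi> x + t \<psi> y) M (f x) (h y)\<close>, where \<open>M\<close> is the weighted power mean of
  exponent \<open>-1/n\<close>, then integrating out one coordinate gives a bound of the same form for the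
  marginals, with \<open>\<phi>\<close> and \<open>\<psi>\<close> replaced by their conditional averages and the exponent by
  \<open>-1/(n - 1)\<close>. After \<open>n\<close> steps \<open>M\<close> is the minimum of two total masses equal to 1. The hypothesis
  for \<open>f = g\<^sup>-\<^sup>a\<close>, \<open>h = W\<^sup>-\<^sup>a\<close>, \<open>k = \<Phi>(H) H\<^sup>-\<^sup>a\<close> holds because \<open>\<Phi>\<close> is concave, \<open>\<Phi>(u) u\<^sup>-\<^sup>a\<close> is
  nonincreasing and \<open>a \<ge> n\<close>.
\<close>

section \<open>Domination by Lebesgue measure on the line\<close>

text \<open>An open set is the countable disjoint union of its components, which are open and
  connected, so the bound sums up to open sets. Outer regularity of \<open>lborel\<close> carries it
  to Borel sets; \<open>N\<close> is not assumed finite.\<close>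

lemma emeasure_le_lborel_if_connected_open:
  fixes N :: "real measure"
  assumes [measurable_cong]: "sets N = sets borel"
    and conn: "\<And>C. open C \<Longrightarrow> connected C \<Longrightarrow> emeasure N C \<le> emeasure lborel C"
    and E[measurable]: "E \<in> sets borel"
  shows "emeasure N E \<le> emeasure lborel E"
proof -
  have opn: "emeasure N U \<le> emeasure lborel U" if "open U" for U
  proof -
    have o: "open C" if "C \<in> components U" for C
      using \<open>open U\<close> that open_components by blast
    have cnt: "countable (components U)"
      using o pairwise_disjoint_components[of U]
      by (intro countable_disjoint_open_subsets) (auto simp: pairwise_def disjnt_def)
    have dis: "disjoint_family_on (\<lambda>C. C) (components U)"
      using pairwise_disjoint_components[of U] by (auto simp: pairwise_def disjoint_family_on_def)
    have "emeasure N (\<Union>((\<lambda>C. C) ` components U)) = (\<integral>\<^sup>+C. emeasure N C \<partial>count_space (components U))"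
      using o cnt dis by (intro emeasure_UN_countable) auto
    also have "\<dots> \<le> (\<integral>\<^sup>+C. emeasure lborel C \<partial>count_space (components U))"
      by (intro nn_integral_mono conn) (auto intro: o in_components_connected)
    also have "\<dots> = emeasure lborel (\<Union>((\<lambda>C. C) ` components U))"
      using o cnt dis by (intro emeasure_UN_countable[symmetric]) auto
    finally show ?thesis by simp
  qed
  show ?thesis
  proof (rule ennreal_le_epsilon)
    fix e :: real assume "0 < e"
    obtain U where U: "open U" "E \<subseteq> U" "emeasure lborel (U - E) < e"
      using outer_regular_lborel[OF E \<open>0 < e\<close>] .
    have "emeasure N E \<le> emeasure N U"
      using U by (intro emeasure_mono) (auto simp: assms(1))
    also have "\<dots> \<le> emeasure lborel U" by (rule opn[OF U(1)])
    also have "\<dots> \<le> emeasure lborel E + emeasure lborel (U - E)"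
    proof -
      have "E \<union> (U - E) = U" using U(2) by auto
      with emeasure_subadditive[of E lborel "U - E"] U(1) show ?thesis by simp
    qed
    also have "\<dots> \<le> emeasure lborel E + e" using U(3) by (intro add_left_mono) auto
    finally show "emeasure N E \<le> emeasure lborel E + e" .
  qed
qed

section \<open>Quantile functions and the change of variables along their weighted sum\<close>

abbreviation "unit_lborel \<equiv> restrict_space lborel {0<..<1::real}"

text \<open>The generalised inverse of the distribution function, as constructed in the locale
  \<open>cdf_distribution\<close>, serves as \<open>U\<close>.\<close>

lemma quantile_exists:
  fixes f :: "real \<Rightarrow> ennreal"
  assumes [measurable]: "f \<in> borel_measurable borel" and 1: "(\<integral>\<^sup>+x. f x \<partial>lborel) = 1"
  obtains U where "mono_on {0<..<1} U" "U \<in> borel_measurable unit_lborel"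
    "distr unit_lborel borel U = density lborel f"
proof -
  have "emeasure (density lborel f) UNIV = 1"
    by (subst emeasure_density) (simp_all add: 1)
  then have "real_distribution (density lborel f)"
    by (intro real_distribution.intro prob_spaceI real_distribution_axioms.intro) simp_all
  then have "cdf_distribution (density lborel f)"
    by (rule cdf_distribution.intro)
  then interpret cdf_distribution "density lborel f" .
  show thesis
    using measurable_CI that[OF mono_I _ distr_I_eq_M]
    by (simp cong: measurable_cong_sets[OF sets_restrict_space_cong[OF sets_lborel] refl])
qed


text \<open>This replaces the formal identity \<open>U' = 1 / f (U p)\<close>: pushing the integral
  forward along \<open>U\<close> produces the factor \<open>f x * inverse (f x)\<close>, which is at
  most 1.\<close>

lemma nn_integral_inverse_density_le:
  fixes f :: "real \<Rightarrow> ennreal"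
  assumes [measurable]: "f \<in> borel_measurable borel" "U \<in> borel_measurable unit_lborel"
    and distr: "distr unit_lborel borel U = density lborel f"
    and J: "\<And>p. p \<in> J \<Longrightarrow> U p \<in> {l..u}"
  shows "(\<integral>\<^sup>+p. indicator J p * inverse (f (U p)) \<partial>unit_lborel) \<le> emeasure lborel {l..u}"
proof -
  have "(\<integral>\<^sup>+p. indicator J p * inverse (f (U p)) \<partial>unit_lborel)
      \<le> (\<integral>\<^sup>+p. indicator {l..u} (U p) * inverse (f (U p)) \<partial>unit_lborel)"
    using J by (intro nn_integral_mono) (auto simp: indicator_def)
  also have "\<dots> = (\<integral>\<^sup>+x. indicator {l..u} x * inverse (f x) \<partial>distr unit_lborel borel U)"
    by (subst nn_integral_distr) auto
  also have "\<dots> = (\<integral>\<^sup>+x. f x * (indicator {l..u} x * inverse (f x)) \<partial>lborel)"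
    unfolding distr by (subst nn_integral_density) auto
  also have "\<dots> \<le> (\<integral>\<^sup>+x. indicator {l..u} x \<partial>lborel)"
  proof (intro nn_integral_mono)
    fix x
    \<comment> \<open>Equality can fail: in \<open>ennreal\<close> the product is 0 where
      \<open>f x\<close> is 0 or infinite.\<close>
    have "f x * inverse (f x) \<le> 1"
    proof (cases "f x")
      case (real r)
      then show ?thesis
        by (cases "r = 0") (auto simp: inverse_ennreal ennreal_mult''[symmetric])
    qed simp
    then show "f x * (indicator {l..u} x * inverse (f x)) \<le> indicator {l..u} x"
      by (auto simp: indicator_def)
  qed
  finally show ?thesis by simp
qed

text \<open>Both functions increase together, so the points where \<open>U\<close> and
  \<open>V\<close> come close to their extremes may be replaced by one common pair. Hence a bound on
  the spread of the sum bounds the weighted sum of the separate spreads.\<close>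

lemma weighted_spread_le:
  fixes U V :: "real \<Rightarrow> real"
  assumes U: "mono_on A U" and V: "mono_on A V" and "0 < s" "0 < t" and J: "J \<subseteq> A" "J \<noteq> {}"
    and d: "\<And>p q. p \<in> J \<Longrightarrow> q \<in> J \<Longrightarrow> p \<le> q \<Longrightarrow> (s * U q + t * V q) - (s * U p + t * V p) \<le> d"
  obtains l u l' u' where "\<And>p. p \<in> J \<Longrightarrow> U p \<in> {l..u}" "\<And>p. p \<in> J \<Longrightarrow> V p \<in> {l'..u'}"
    "l \<le> u" "l' \<le> u'" "s * (u - l) + t * (u' - l') \<le> d"
proof -
  have *: "s * (U q - U p) + t * (V q' - V p') \<le> d" if "p \<in> J" "q \<in> J" "p' \<in> J" "q' \<in> J" for p q p' q'
  proof -
    \<comment> \<open>No order between \<open>p\<close> and \<open>q\<close>, or \<open>p'\<close>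
      and \<open>q'\<close>, is given; the maximum over all four points ensures
      \<open>m \<le> n\<close>.\<close>
    define m where "m = min p p'"
    define n where "n = max (max p p') (max q q')"
    have mn: "m \<in> J" "n \<in> J" "m \<le> n" using that by (auto simp: m_def n_def min_def max_def)
    have "U m \<le> U p" "U q \<le> U n" "V m \<le> V p'" "V q' \<le> V n"
      using that mn J by (auto intro!: mono_onD[OF U] mono_onD[OF V] simp: m_def n_def)
    then have "s * (U q - U p) + t * (V q' - V p') \<le> s * (U n - U m) + t * (V n - V m)"
      using \<open>0 < s\<close> \<open>0 < t\<close> by (intro add_mono mult_left_mono) auto
    also have "\<dots> \<le> d" using d[OF mn] by (simp add: algebra_simps)
    finally show ?thesis .
  qed
  obtain p0 where p0: "p0 \<in> J" using J by auto
  \<comment> \<open>Setting the \<open>V\<close> difference to zero isolates \<open>U\<close>.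
    Without such a bound \<open>Inf\<close> and \<open>Sup\<close> would be meaningless, as
    quantiles may be unbounded near 0 and 1.\<close>
  have bU: "\<bar>U p - U p0\<bar> \<le> d / s" if "p \<in> J" for p
    using *[of p0 p p0 p0] *[of p p0 p0 p0] p0 that \<open>0 < s\<close> by (auto simp: field_simps abs_le_iff)
  have bV: "\<bar>V p - V p0\<bar> \<le> d / t" if "p \<in> J" for p
    using *[of p0 p0 p0 p] *[of p0 p0 p p0] p0 that \<open>0 < t\<close> by (auto simp: field_simps abs_le_iff)
  have "bdd_above (U ` J)"
    by (intro bdd_aboveI2[where M="U p0 + d / s"]) (use bU in \<open>force simp: abs_le_iff algebra_simps\<close>)
  moreover have "bdd_below (U ` J)"
    by (intro bdd_belowI2[where m="U p0 - d / s"]) (use bU in \<open>force simp: abs_le_iff algebra_simps\<close>)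
  moreover have "bdd_above (V ` J)"
    by (intro bdd_aboveI2[where M="V p0 + d / t"]) (use bV in \<open>force simp: abs_le_iff algebra_simps\<close>)
  moreover have "bdd_below (V ` J)"
    by (intro bdd_belowI2[where m="V p0 - d / t"]) (use bV in \<open>force simp: abs_le_iff algebra_simps\<close>)
  ultimately have bdd: "bdd_above (U ` J)" "bdd_below (U ` J)" "bdd_above (V ` J)" "bdd_below (V ` J)" .
  define l u l' u' where "l = Inf (U ` J)" "u = Sup (U ` J)" "l' = Inf (V ` J)" "u' = Sup (V ` J)"
  have mem: "U p \<in> {l..u}" "V p \<in> {l'..u'}" if "p \<in> J" for p
    using that bdd unfolding l_u_l'_u'_def by (auto intro: cINF_lower cSUP_upper)
  have "s * (u - l) + t * (u' - l') \<le> d"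
  proof (rule field_le_epsilon)
    fix e :: real assume "0 < e"
    \<comment> \<open>Each of the two differences will lose at most \<open>2 * \<epsilon>\<close>,
      and these losses add up to \<open>e\<close> after weighting.\<close>
    define \<epsilon> where "\<epsilon> = e / 2 / (s + t)"
    have "0 < s + t" using \<open>0 < s\<close> \<open>0 < t\<close> by simp
    then have "e / 2 = \<epsilon> * (s + t)"
      unfolding \<epsilon>_def by (intro nonzero_divide_eq_eq[THEN iffD1, OF _ refl]) simp
    moreover have "0 < \<epsilon>"
      unfolding \<epsilon>_def using \<open>0 < e\<close> \<open>0 < s + t\<close> by (intro divide_pos_pos) auto
    ultimately have \<epsilon>: "0 < \<epsilon>" "2 * (s * \<epsilon> + t * \<epsilon>) = e"
      by (simp_all add: algebra_simps)
    obtain p where p: "p \<in> J" "U p < l + \<epsilon>"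
      using cInf_lessD[of "U ` J" "l + \<epsilon>"] J \<epsilon> by (auto simp: l_u_l'_u'_def)
    obtain q where q: "q \<in> J" "u - \<epsilon> < U q"
      using less_cSupD[of "U ` J" "u - \<epsilon>"] J \<epsilon> by (auto simp: l_u_l'_u'_def)
    obtain p' where p': "p' \<in> J" "V p' < l' + \<epsilon>"
      using cInf_lessD[of "V ` J" "l' + \<epsilon>"] J \<epsilon> by (auto simp: l_u_l'_u'_def)
    obtain q' where q': "q' \<in> J" "u' - \<epsilon> < V q'"
      using less_cSupD[of "V ` J" "u' - \<epsilon>"] J \<epsilon> by (auto simp: l_u_l'_u'_def)
    have "s * (u - l) + t * (u' - l') \<le> s * ((U q - U p) + 2 * \<epsilon>) + t * ((V q' - V p') + 2 * \<epsilon>)"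
      using p q p' q' \<open>0 < s\<close> \<open>0 < t\<close> by (intro add_mono mult_left_mono) auto
    also have "\<dots> = s * (U q - U p) + t * (V q' - V p') + 2 * (s * \<epsilon> + t * \<epsilon>)"
      by (simp add: algebra_simps)
    also have "\<dots> \<le> d + e" using *[of p q p' q'] p q p' q' \<epsilon> by auto
    finally show "s * (u - l) + t * (u' - l') \<le> d + e" .
  qed
  moreover have "l \<le> u" "l' \<le> u'" using mem[OF p0] by auto
  ultimately show thesis using that mem by blast
qed

text \<open>Formally the substitution \<open>x = Z p\<close>, with the weight \<open>w\<close> in
  the role of the derivative of \<open>Z\<close>. Rigorously, the image \<open>N\<close> of
  \<open>w dp\<close> under \<open>Z\<close> gives every open interval at most its length, hence is
  dominated by \<open>lborel\<close>.\<close>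

lemma nn_integral_quantile_average_le:
  fixes f h k :: "real \<Rightarrow> ennreal"
  assumes f[measurable]: "f \<in> borel_measurable borel" and h[measurable]: "h \<in> borel_measurable borel"
    and k[measurable]: "k \<in> borel_measurable borel"
    and U: "mono_on {0<..<1} U" and V: "mono_on {0<..<1} V"
    and mU[measurable]: "U \<in> borel_measurable unit_lborel"
    and mV[measurable]: "V \<in> borel_measurable unit_lborel"
    and dU: "distr unit_lborel borel U = density lborel f"
    and dV: "distr unit_lborel borel V = density lborel h"
    and st: "0 < s" "0 < t"
  shows "(\<integral>\<^sup>+p. k (s * U p + t * V p) * (ennreal s * inverse (f (U p)) + ennreal t * inverse (h (V p))) \<partial>unit_lborel)
    \<le> (\<integral>\<^sup>+x. k x \<partial>lborel)"
proof -
  define Z where "Z p = s * U p + t * V p" for p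
  define w where "w p = ennreal s * inverse (f (U p)) + ennreal t * inverse (h (V p))" for p
  have [measurable]: "Z \<in> borel_measurable unit_lborel" "w \<in> borel_measurable unit_lborel"
    unfolding Z_def w_def by measurable
  define N where "N = distr (density unit_lborel w) borel Z"
  have sN: "sets N = sets borel" by (simp add: N_def)
  have "emeasure N C \<le> emeasure lborel C" if C: "open C" "connected C" for C
  proof -
    have [measurable]: "C \<in> sets borel" using C by auto
    define J where "J = {p\<in>{0<..<1}. Z p \<in> C}"
    have eq: "emeasure N C = (\<integral>\<^sup>+p. indicator J p * w p \<partial>unit_lborel)"
    proof -
      have "emeasure N C = (\<integral>\<^sup>+x. indicator C x \<partial>N)"
        using C sN by simp
      also have "\<dots> = (\<integral>\<^sup>+p. indicator C (Z p) \<partial>density unit_lborel w)"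
        unfolding N_def using C by (subst nn_integral_distr) auto
      also have "\<dots> = (\<integral>\<^sup>+p. w p * indicator C (Z p) \<partial>unit_lborel)"
        using C by (subst nn_integral_density) auto
      also have "\<dots> = (\<integral>\<^sup>+p. indicator J p * w p \<partial>unit_lborel)"
        by (intro nn_integral_cong) (auto simp: J_def indicator_def space_restrict_space)
      finally show ?thesis .
    qed
    show ?thesis
    proof (cases "J = {} \<or> emeasure lborel C = \<infinity>")
      case True
      then show ?thesis by (auto simp: eq)
    next
      case False
      then have "emeasure lborel C < \<infinity>" by (simp add: less_top)
      then obtain d where d: "0 \<le> d" "emeasure lborel C = ennreal d"
        by (cases "emeasure lborel C") auto
      have "Z q - Z p \<le> d" if "p \<in> J" "q \<in> J" "p \<le> q" for p q
      proof -
        have "Z p \<le> Z q"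
          unfolding Z_def using that st
          by (intro add_mono mult_left_mono mono_onD[OF U] mono_onD[OF V]) (auto simp: J_def)
        \<comment> \<open>Connectedness of \<open>C\<close> turns its measure \<open>d\<close> into
          a bound on the spread of \<open>Z\<close> over \<open>J\<close>.\<close>
        have "{Z p..Z q} \<subseteq> C"
          using C(2) that by (intro connected_contains_Icc) (auto simp: J_def)
        then have "emeasure lborel {Z p..Z q} \<le> ennreal d"
          unfolding d(2)[symmetric] using C by (intro emeasure_mono) auto
        then show ?thesis using \<open>Z p \<le> Z q\<close> d(1) by (simp add: ennreal_le_iff)
      qed
      then obtain l u l' u' where lu: "\<And>p. p \<in> J \<Longrightarrow> U p \<in> {l..u}" "\<And>p. p \<in> J \<Longrightarrow> V p \<in> {l'..u'}"
        and le: "l \<le> u" "l' \<le> u'" "s * (u - l) + t * (u' - l') \<le> d"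
        using False weighted_spread_le[OF U V st, of J d] unfolding Z_def J_def by blast
      have [measurable]: "J \<in> sets unit_lborel"
      proof -
        have "J = Z -` C \<inter> space unit_lborel" by (auto simp: J_def space_restrict_space)
        also have "\<dots> \<in> sets unit_lborel" using C by (intro measurable_sets[of _ _ borel]) auto
        finally show ?thesis .
      qed
      have "emeasure N C = (\<integral>\<^sup>+p. ennreal s * (indicator J p * inverse (f (U p)))
            + ennreal t * (indicator J p * inverse (h (V p))) \<partial>unit_lborel)"
        unfolding eq w_def by (intro nn_integral_cong) (simp add: algebra_simps)
      also have "\<dots> = ennreal s * (\<integral>\<^sup>+p. indicator J p * inverse (f (U p)) \<partial>unit_lborel)
            + ennreal t * (\<integral>\<^sup>+p. indicator J p * inverse (h (V p)) \<partial>unit_lborel)"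
        by (subst nn_integral_add) (auto simp: nn_integral_cmult)
      also have "\<dots> \<le> ennreal s * emeasure lborel {l..u} + ennreal t * emeasure lborel {l'..u'}"
        by (intro add_mono mult_left_mono nn_integral_inverse_density_le f h mU mV dU dV lu) auto
      also have "\<dots> = ennreal (s * (u - l) + t * (u' - l'))"
        using le st by (simp add: ennreal_mult ennreal_plus)
      also have "\<dots> \<le> ennreal d" using le by (intro ennreal_leI)
      finally show ?thesis by (simp add: d)
    qed
  qed
  note N_le = emeasure_le_lborel_if_connected_open[OF sN this]
  have "(\<integral>\<^sup>+p. k (Z p) * w p \<partial>unit_lborel) = (\<integral>\<^sup>+x. k x \<partial>N)"
    unfolding N_def by (subst nn_integral_distr, simp, simp, subst nn_integral_density) (auto simp: mult.commute)
  also have "\<dots> \<le> (\<integral>\<^sup>+x. k x \<partial>lborel)"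
    using N_le sN by (intro nn_integral_mono_measure) (auto simp: le_measure)
  finally show ?thesis unfolding Z_def w_def .
qed

section \<open>Power means\<close>

text \<open>The power mean of exponent \<open>-1/m\<close>; the minimum is its limit as the exponent tends to \<open>-\<infinity>\<close>.\<close>

definition power_mean :: "real \<Rightarrow> real \<Rightarrow> nat \<Rightarrow> real \<Rightarrow> real \<Rightarrow> real" where
  "power_mean s t m x y =
     (if m = 0 then min x y else 1 / (s * x powr (- 1 / real m) + t * y powr (- 1 / real m)) ^ m)"

lemma power_mean_pos: "0 < s \<Longrightarrow> 0 < t \<Longrightarrow> 0 < x \<Longrightarrow> 0 < y \<Longrightarrow> 0 < power_mean s t m x y"
  by (auto simp: power_mean_def intro!: add_pos_pos zero_less_power)

text \<open>A two-term Hoelder inequality: Jensen for \<open>z\<^sup>m\<^sup>+\<^sup>1\<close> with weights \<open>s c / S\<close> and \<open>t d / S\<close>.\<close>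

lemma power_mean_le_mult:
  assumes st: "0 < s" "0 < t" "s + t = 1" and pos: "0 < x" "0 < y" "0 < a" "0 < b"
  shows "power_mean s t m a b \<le> power_mean s t (Suc m) x y * (s * (a / x) + t * (b / y))"
proof (cases "m = 0")
  case True
  have "min a b * (s / x + t / y) \<le> s * (a / x) + t * (b / y)"
  proof -
    have "min a b * (s / x) + min a b * (t / y) \<le> a * (s / x) + b * (t / y)"
      using st pos by (intro add_mono mult_right_mono) auto
    then show ?thesis by (simp add: algebra_simps)
  qed
  moreover have "0 < s / x + t / y" using st pos by (intro add_pos_pos) auto
  ultimately have "min a b \<le> (s * (a / x) + t * (b / y)) / (s / x + t / y)"
    by (simp add: pos_le_divide_eq)
  then show ?thesis
    using True pos by (simp add: power_mean_def powr_minus_divide)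
next
  case False
  define n where "n = Suc m"
  define p q where "p = x powr (- 1 / real n)" "q = y powr (- 1 / real n)"
  define c d where "c = a powr (- 1 / real m)" "d = b powr (- 1 / real m)"
  have pos': "0 < p" "0 < q" "0 < c" "0 < d" using pos by (auto simp: p_q_def c_d_def)
  have pw: "(z powr (- 1 / real j)) ^ j = 1 / z" if "0 < z" "0 < j" for z j
  proof -
    have "(z powr (- 1 / real j)) ^ j = z powr (real j * (- 1 / real j))"
      using that by (intro powr_power) auto
    also have "real j * (- 1 / real j) = - 1" using that by simp
    finally show ?thesis using that by (simp add: powr_minus_divide)
  qed
  have pw: "p ^ n = 1 / x" "q ^ n = 1 / y" "c ^ m = 1 / a" "d ^ m = 1 / b"
    using pw[OF pos(1), of n] pw[OF pos(2), of n] pw[OF pos(3), of m] pw[OF pos(4), of m] False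
    unfolding p_q_def c_d_def by (simp_all only: n_def zero_less_Suc neq0_conv)
  define S where "S = s * c + t * d"
  have S: "0 < S" using st pos' by (auto simp: S_def intro!: add_pos_pos)
  have conv: "convex_on {0<..} (\<lambda>z::real. z ^ n)" 
    by (cases "even n") (auto intro: convex_on_subset[OF convex_power_even] convex_on_subset[OF convex_power_odd])
  have "((s * c / S) * (p / c) + (t * d / S) * (q / d)) ^ n
      \<le> (s * c / S) * (p / c) ^ n + (t * d / S) * (q / d) ^ n"
    using st pos' S convex_onD[OF conv, of "t * d / S" "p / c" "q / d"]
    by (auto simp: S_def field_simps)
  also have "(s * c / S) * (p / c) + (t * d / S) * (q / d) = (s * p + t * q) / S"
    using pos' by (simp add: add_divide_distrib)
  also have "(s * c / S) * (p / c) ^ n + (t * d / S) * (q / d) ^ n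
     = (s * (p ^ n / c ^ m) + t * (q ^ n / d ^ m)) / S"
    using pos' by (simp add: n_def power_divide add_divide_distrib mult.commute)
  also have "\<dots> = (s * (a / x) + t * (b / y)) / S"
    by (simp add: pw)
  \<comment> \<open>Of the \<open>n = m + 1\<close> factors \<open>S\<close>, one cancels the
    denominator on the right; the remaining \<open>S ^ m\<close> is the reciprocal of
    \<open>power_mean s t m a b\<close>.\<close>
  finally have "((s * p + t * q) / S) ^ n * S ^ n \<le> (s * (a / x) + t * (b / y)) / S * S ^ n"
    using S by (intro mult_right_mono) auto
  then have "(s * p + t * q) ^ n \<le> (s * (a / x) + t * (b / y)) * S ^ m"
    using S by (simp add: n_def power_divide del: times_divide_eq_right)
  moreover have "0 < (s * p + t * q) ^ n" using st pos' by (intro zero_less_power add_pos_pos) auto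
  ultimately have "1 / S ^ m \<le> 1 / (s * p + t * q) ^ n * (s * (a / x) + t * (b / y))"
    using S by (simp add: pos_divide_le_eq pos_le_divide_eq mult.commute)
  moreover have "power_mean s t m a b = 1 / S ^ m"
    using False by (simp add: power_mean_def S_def c_d_def)
  moreover have "power_mean s t (Suc m) x y = 1 / (s * p + t * q) ^ n"
    by (simp add: power_mean_def p_q_def n_def)
  ultimately show ?thesis by (simp only:)
qed

section \<open>Integrating out coordinates\<close>

text \<open>Take the quantiles of the normalised densities \<open>f / a\<close> and
  \<open>h / b\<close>. The weight of the substitution at \<open>p\<close> is then
  \<open>s * (a / u) + t * (b / v)\<close>, exactly the factor by which
  \<open>power_mean_le_mult\<close> passes from \<open>Suc m\<close> to \<open>m\<close>.\<close>

lemma nn_integral_ge_power_mean_real: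
  fixes f h k \<phi> \<psi> :: "real \<Rightarrow> ennreal"
  assumes f[measurable]: "f \<in> borel_measurable borel" and h[measurable]: "h \<in> borel_measurable borel"
    and k[measurable]: "k \<in> borel_measurable borel"
    and [measurable]: "\<phi> \<in> borel_measurable borel" "\<psi> \<in> borel_measurable borel"
    and st: "0 < s" "0 < t" "s + t = 1" and pos: "0 < a" "0 < b"
    and fa: "(\<integral>\<^sup>+x. f x \<partial>lborel) = ennreal a" and hb: "(\<integral>\<^sup>+x. h x \<partial>lborel) = ennreal b"
    and le: "\<And>x y u v. f x = ennreal u \<Longrightarrow> h y = ennreal v \<Longrightarrow> 0 < u \<Longrightarrow> 0 < v \<Longrightarrow>
      (ennreal s * \<phi> x + ennreal t * \<psi> y) * ennreal (power_mean s t (Suc m) u v) \<le> k (s * x + t * y)"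
  shows "(ennreal s * ((\<integral>\<^sup>+x. \<phi> x * f x \<partial>lborel) / ennreal a) + ennreal t * ((\<integral>\<^sup>+x. \<psi> x * h x \<partial>lborel) / ennreal b))
      * ennreal (power_mean s t m a b) \<le> (\<integral>\<^sup>+x. k x \<partial>lborel)"
proof -
  define f' where "f' x = f x / ennreal a" for x
  define h' where "h' x = h x / ennreal b" for x
  have [measurable]: "f' \<in> borel_measurable borel" "h' \<in> borel_measurable borel"
    unfolding f'_def h'_def by measurable
  have f'1: "(\<integral>\<^sup>+x. f' x \<partial>lborel) = 1" and h'1: "(\<integral>\<^sup>+x. h' x \<partial>lborel) = 1"
    using pos by (simp_all add: f'_def h'_def nn_integral_divide fa hb ennreal_divide_self)
  obtain U where U: "mono_on {0<..<1} U" and [measurable]: "U \<in> borel_measurable unit_lborel"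
    and dU: "distr unit_lborel borel U = density lborel f'"
    using quantile_exists[OF _ f'1] by auto
  obtain V where V: "mono_on {0<..<1} V" and [measurable]: "V \<in> borel_measurable unit_lborel"
    and dV: "distr unit_lborel borel V = density lborel h'"
    using quantile_exists[OF _ h'1] by auto
  \<comment> \<open>The hypothesis \<open>le\<close> covers only positive finite densities; the
    quantiles almost surely avoid all other values.\<close>
  have "AE x in density lborel f'. 0 < f' x \<and> f' x < \<infinity>"
    using nn_integral_noteq_infinite[of f' lborel] f'1 by (subst AE_density) (auto simp: less_top)
  then have AEU: "AE p in unit_lborel. 0 < f' (U p) \<and> f' (U p) < \<infinity>"
    unfolding dU[symmetric] by (subst (asm) AE_distr_iff) auto
  have "AE x in density lborel h'. 0 < h' x \<and> h' x < \<infinity>"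
    using nn_integral_noteq_infinite[of h' lborel] h'1 by (subst AE_density) (auto simp: less_top)
  then have AEV: "AE p in unit_lborel. 0 < h' (V p) \<and> h' (V p) < \<infinity>"
    unfolding dV[symmetric] by (subst (asm) AE_distr_iff) auto
  have "(\<integral>\<^sup>+p. \<phi> (U p) \<partial>unit_lborel) = (\<integral>\<^sup>+x. f' x * \<phi> x \<partial>lborel)"
    by (subst nn_integral_density[symmetric], simp, simp, subst dU[symmetric], subst nn_integral_distr) auto
  also have "\<dots> = (\<integral>\<^sup>+x. \<phi> x * f x / ennreal a \<partial>lborel)"
    by (simp add: f'_def divide_ennreal_def mult_ac)
  also have "\<dots> = (\<integral>\<^sup>+x. \<phi> x * f x \<partial>lborel) / ennreal a"
    by (simp add: nn_integral_divide)
  finally have IU: "(\<integral>\<^sup>+p. \<phi> (U p) \<partial>unit_lborel) = (\<integral>\<^sup>+x. \<phi> x * f x \<partial>lborel) / ennreal a" .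
  have "(\<integral>\<^sup>+p. \<psi> (V p) \<partial>unit_lborel) = (\<integral>\<^sup>+x. h' x * \<psi> x \<partial>lborel)"
    by (subst nn_integral_density[symmetric], simp, simp, subst dV[symmetric], subst nn_integral_distr) auto
  also have "\<dots> = (\<integral>\<^sup>+x. \<psi> x * h x / ennreal b \<partial>lborel)"
    by (simp add: h'_def divide_ennreal_def mult_ac)
  also have "\<dots> = (\<integral>\<^sup>+x. \<psi> x * h x \<partial>lborel) / ennreal b"
    by (simp add: nn_integral_divide)
  finally have IV: "(\<integral>\<^sup>+p. \<psi> (V p) \<partial>unit_lborel) = (\<integral>\<^sup>+x. \<psi> x * h x \<partial>lborel) / ennreal b" .
  have "(ennreal s * ((\<integral>\<^sup>+x. \<phi> x * f x \<partial>lborel) / ennreal a) + ennreal t * ((\<integral>\<^sup>+x. \<psi> x * h x \<partial>lborel) / ennreal b))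
      * ennreal (power_mean s t m a b)
    = (\<integral>\<^sup>+p. (ennreal s * \<phi> (U p) + ennreal t * \<psi> (V p)) * ennreal (power_mean s t m a b) \<partial>unit_lborel)"
    by (simp add: nn_integral_multc nn_integral_add nn_integral_cmult IU IV)
  also have "\<dots> \<le> (\<integral>\<^sup>+p. k (s * U p + t * V p) * (ennreal s * inverse (f' (U p)) + ennreal t * inverse (h' (V p))) \<partial>unit_lborel)"
    using AEU AEV
  proof (intro nn_integral_mono_AE, eventually_elim)
    case (elim p)
    obtain u where u: "f (U p) = ennreal u" "0 < u"
      using elim pos by (cases "f (U p)") (auto simp: f'_def ennreal_zero_less_divide ennreal_top_divide)
    obtain v where v: "h (V p) = ennreal v" "0 < v"
      using elim pos by (cases "h (V p)") (auto simp: h'_def ennreal_zero_less_divide ennreal_top_divide)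
    let ?w = "s * (a / u) + t * (b / v)"
    have w: "ennreal s * inverse (f' (U p)) + ennreal t * inverse (h' (V p)) = ennreal ?w"
    proof -
      have "inverse (f' (U p)) = ennreal (a / u)" "inverse (h' (V p)) = ennreal (b / v)"
        using u v pos by (simp_all add: f'_def h'_def divide_ennreal inverse_ennreal)
      then show ?thesis
        using u v pos st by (simp add: ennreal_mult ennreal_plus del: times_divide_eq_right)
    qed
    have "(ennreal s * \<phi> (U p) + ennreal t * \<psi> (V p)) * ennreal (power_mean s t m a b)
      \<le> (ennreal s * \<phi> (U p) + ennreal t * \<psi> (V p)) * ennreal (power_mean s t (Suc m) u v * ?w)"
      using st pos u v by (intro mult_left_mono ennreal_leI power_mean_le_mult) auto
    also have "\<dots> = (ennreal s * \<phi> (U p) + ennreal t * \<psi> (V p)) * ennreal (power_mean s t (Suc m) u v) * ennreal ?w"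
      using st pos u v power_mean_pos[of s t u v "Suc m"] by (simp add: ennreal_mult' mult_ac)
    also have "\<dots> \<le> k (s * U p + t * V p) * ennreal ?w"
      using u v by (intro mult_right_mono le) auto
    finally show ?case unfolding w .
  qed
  also have "\<dots> \<le> (\<integral>\<^sup>+x. k x \<partial>lborel)"
    by (intro nn_integral_quantile_average_le U V dU dV st) auto
  finally show ?thesis .
qed

text \<open>Induction on the index set. The fibre integrals \<open>F\<close>, \<open>G\<close>,
  \<open>K\<close> inherit the hypothesis with one coordinate fewer, the weights becoming the
  conditional averages \<open>P / F\<close> and \<open>Q / G\<close>. This is why
  \<open>\<phi>\<close> and \<open>\<psi>\<close> are arbitrary functions, generalised in the
  induction.\<close>

lemma nn_integral_ge_power_mean_PiM:
  fixes f h k \<phi> \<psi> :: "('i \<Rightarrow> real) \<Rightarrow> ennreal"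
  assumes I: "finite I" and st: "0 < s" "0 < t" "s + t = 1"
    and "f \<in> borel_measurable (PiM I (\<lambda>_. lborel))" "h \<in> borel_measurable (PiM I (\<lambda>_. lborel))"
    "k \<in> borel_measurable (PiM I (\<lambda>_. lborel))"
    "\<phi> \<in> borel_measurable (PiM I (\<lambda>_. lborel))" "\<psi> \<in> borel_measurable (PiM I (\<lambda>_. lborel))"
    and "(\<integral>\<^sup>+x. f x \<partial>PiM I (\<lambda>_. lborel)) = 1" "(\<integral>\<^sup>+x. h x \<partial>PiM I (\<lambda>_. lborel)) = 1"
    and "\<And>x y u v. x \<in> space (PiM I (\<lambda>_. lborel)) \<Longrightarrow> y \<in> space (PiM I (\<lambda>_. lborel)) \<Longrightarrow>
      f x = ennreal u \<Longrightarrow> h y = ennreal v \<Longrightarrow> 0 < u \<Longrightarrow> 0 < v \<Longrightarrow>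
      (ennreal s * \<phi> x + ennreal t * \<psi> y) * ennreal (power_mean s t (card I) u v) \<le> k (\<lambda>i. s * x i + t * y i)"
  shows "ennreal s * (\<integral>\<^sup>+x. \<phi> x * f x \<partial>PiM I (\<lambda>_. lborel)) + ennreal t * (\<integral>\<^sup>+x. \<psi> x * h x \<partial>PiM I (\<lambda>_. lborel))
      \<le> (\<integral>\<^sup>+x. k x \<partial>PiM I (\<lambda>_. lborel))"
  using I assms(5-)
proof (induction I arbitrary: f h k \<phi> \<psi> rule: finite_induct)
  case empty
  interpret product_sigma_finite "\<lambda>_::'i. lborel :: real measure" ..
  \<comment> \<open>The only point of the empty product is constantly \<open>undefined\<close>; it
    is its own weighted sum because the weights add up to 1.\<close>
  have "s * z + t * z = z" for z :: real using st by (simp add: distrib_right[symmetric])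
  moreover have "f (\<lambda>_. undefined) = ennreal 1" "h (\<lambda>_. undefined) = ennreal 1"
    using empty.prems(6,7) by (simp_all add: nn_integral_empty)
  ultimately show ?case
    using empty.prems(8)[of "\<lambda>_. undefined" "\<lambda>_. undefined" 1 1]
    by (simp add: nn_integral_empty power_mean_def space_PiM)
next
  case (insert i I)
  note [measurable] = insert.prems(1-5)
  let ?P = "PiM I (\<lambda>_. lborel :: real measure)"
  interpret product_sigma_finite "\<lambda>_::'i. lborel :: real measure" ..
  define F where "F x = (\<integral>\<^sup>+z. f (x(i := z)) \<partial>lborel)" for x
  define G where "G x = (\<integral>\<^sup>+z. h (x(i := z)) \<partial>lborel)" for x
  define K where "K x = (\<integral>\<^sup>+z. k (x(i := z)) \<partial>lborel)" for x
  define P where "P x = (\<integral>\<^sup>+z. \<phi> (x(i := z)) * f (x(i := z)) \<partial>lborel)" for x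
  define Q where "Q x = (\<integral>\<^sup>+z. \<psi> (x(i := z)) * h (x(i := z)) \<partial>lborel)" for x
  have [measurable]: "F \<in> borel_measurable ?P" "G \<in> borel_measurable ?P" "K \<in> borel_measurable ?P"
    "P \<in> borel_measurable ?P" "Q \<in> borel_measurable ?P"
    unfolding F_def G_def K_def P_def Q_def by measurable
  have F1: "(\<integral>\<^sup>+x. F x \<partial>?P) = 1" and G1: "(\<integral>\<^sup>+x. G x \<partial>?P) = 1"
    using insert.prems(6,7) insert.hyps by (simp_all add: product_nn_integral_insert F_def G_def)
  have fib: "(\<lambda>z. g (x(i := z))) \<in> borel_measurable borel"
    if "g \<in> borel_measurable (PiM (insert i I) (\<lambda>_. lborel))" "x \<in> space ?P" for g :: "('i \<Rightarrow> real) \<Rightarrow> ennreal" and x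
    using measurable_comp[OF measurable_component_update[OF that(2) insert.hyps(2)] that(1)]
    by (simp add: comp_def)
  have main: "(ennreal s * (P x / F x) + ennreal t * (Q y / G y)) * ennreal (power_mean s t (card I) a b)
      \<le> K (\<lambda>i. s * x i + t * y i)"
    if x: "x \<in> space ?P" and y: "y \<in> space ?P" and ab: "F x = ennreal a" "G y = ennreal b" "0 < a" "0 < b" for x y a b
    unfolding P_def Q_def K_def unfolding ab
  proof (rule nn_integral_ge_power_mean_real[OF fib fib fib fib fib st ab(3,4)])
    \<comment> \<open>Outside \<open>I\<close> both points are \<open>undefined\<close>, and weights
      adding up to 1 preserve this.\<close>
    have xy: "(\<lambda>i. s * x i + t * y i) \<in> space ?P"
    proof -
      have "s * z + t * z = z" for z :: real using st by (simp add: distrib_right[symmetric])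
      then show ?thesis using x y by (auto simp: space_PiM PiE_iff extensional_def)
    qed
    show "x \<in> space ?P" "y \<in> space ?P" "(\<lambda>i. s * x i + t * y i) \<in> space ?P" "x \<in> space ?P" "y \<in> space ?P"
      by fact+
    show "(\<integral>\<^sup>+z. f (x(i := z)) \<partial>lborel) = ennreal a" "(\<integral>\<^sup>+z. h (y(i := z)) \<partial>lborel) = ennreal b"
      using ab by (simp_all add: F_def G_def)
    fix z z' u v
    assume uv: "f (x(i := z)) = ennreal u" "h (y(i := z')) = ennreal v" "0 < u" "0 < v"
    have "(\<lambda>j. s * (x(i := z)) j + t * (y(i := z')) j) = (\<lambda>j. s * x j + t * y j)(i := s * z + t * z')"
      by auto
    moreover have upd: "x(i := z) \<in> space (PiM (insert i I) (\<lambda>_. lborel))"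
      if "x \<in> space ?P" for x and z :: real
      using that by (auto simp: space_PiM PiE_iff extensional_def)
    ultimately show "(ennreal s * \<phi> (x(i := z)) + ennreal t * \<psi> (y(i := z'))) * ennreal (power_mean s t (Suc (card I)) u v)
      \<le> k ((\<lambda>j. s * x j + t * y j)(i := s * z + t * z'))"
      using insert.prems(8)[OF upd[OF x] upd[OF y] uv] insert.hyps by (simp del: fun_upd_apply)
  qed fact+
  have IH: "ennreal s * (\<integral>\<^sup>+x. P x / F x * F x \<partial>?P) + ennreal t * (\<integral>\<^sup>+x. Q x / G x * G x \<partial>?P) \<le> (\<integral>\<^sup>+x. K x \<partial>?P)"
    using main by (intro insert.IH F1 G1) auto
  \<comment> \<open>\<open>F'\<close> is finite almost everywhere because its integral is 1. Where
    it vanishes, \<open>f'\<close> is zero almost everywhere on the fibre, so \<open>P'\<close>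
    vanishes too and the convention for division by zero does no harm.\<close>
  have cancel: "(\<integral>\<^sup>+x. P' x / F' x * F' x \<partial>?P) = (\<integral>\<^sup>+x. P' x \<partial>?P)"
    if [measurable]: "f' \<in> borel_measurable (PiM (insert i I) (\<lambda>_. lborel))" "\<phi>' \<in> borel_measurable (PiM (insert i I) (\<lambda>_. lborel))"
      "F' \<in> borel_measurable ?P"
      and F': "\<And>x. F' x = (\<integral>\<^sup>+z. f' (x(i := z)) \<partial>lborel)" "(\<integral>\<^sup>+x. F' x \<partial>?P) = 1"
      and P': "\<And>x. P' x = (\<integral>\<^sup>+z. \<phi>' (x(i := z)) * f' (x(i := z)) \<partial>lborel)" for f' \<phi>' F' P'
  proof (rule nn_integral_cong_AE)
    have "AE x in ?P. F' x \<noteq> \<infinity>"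
      using F' by (intro nn_integral_noteq_infinite) auto
    then show "AE x in ?P. P' x / F' x * F' x = P' x"
      using AE_space
    proof eventually_elim
      case (elim x)
      show ?case
      proof (cases "F' x = 0")
        case True
        then have "AE z in lborel. f' (x(i := z)) = 0"
          using fib[OF that(1)] elim by (subst nn_integral_0_iff_AE[symmetric]) (auto simp: F'(1))
        then have "AE z in lborel. \<phi>' (x(i := z)) * f' (x(i := z)) = 0"
          by eventually_elim simp
        then have "P' x = 0"
          using fib[OF that(1)] fib[OF that(2)] elim unfolding P'(1) by (subst nn_integral_0_iff_AE) auto
        then show ?thesis by simp
      next
        case False
        then show ?thesis using elim by (simp add: ennreal_divide_times less_top)
      qed
    qed
  qed
  show ?case
    using IH insert.hyps cancel[OF _ _ _ F_def F1 P_def] cancel[OF _ _ _ G_def G1 Q_def]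
    by (simp add: product_nn_integral_insert P_def Q_def K_def)
qed

section \<open>Concavity and the pointwise inequality\<close>

text \<open>Concavity and \<open>\<Phi> 0 \<ge> 0\<close> make \<open>\<Phi> u / u\<close>
  nonincreasing; the remaining factor \<open>u powr (1 - a)\<close> is nonincreasing since
  \<open>a \<ge> 1\<close>.\<close>

lemma concave_weighted_powr_antimono:
  fixes \<Phi> :: "real \<Rightarrow> real"
  assumes conc: "concave_on {0..} \<Phi>" and nonneg: "\<And>u. 0 \<le> u \<Longrightarrow> 0 \<le> \<Phi> u"
    and "1 \<le> a" and xy: "0 < x" "x \<le> y"
  shows "\<Phi> y * y powr (- a) \<le> \<Phi> x * x powr (- a)"
proof -
  have y: "0 < y" using xy by simp
  have "(1 - x / y) * \<Phi> 0 + (x / y) * \<Phi> y \<le> \<Phi> ((1 - x / y) *\<^sub>R 0 + (x / y) *\<^sub>R y)"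
    using xy y by (intro concave_onD[OF conc]) auto
  moreover have "0 \<le> (1 - x / y) * \<Phi> 0"
    using xy y nonneg[of 0] by (intro mult_nonneg_nonneg) auto
  ultimately have "x / y * \<Phi> y \<le> \<Phi> x" using y by simp
  then have "\<Phi> y / y \<le> \<Phi> x / x" using xy y by (simp add: field_simps)
  then have "\<Phi> y / y * y powr (1 - a) \<le> \<Phi> x / x * x powr (1 - a)"
    using xy y nonneg[of x] \<open>1 \<le> a\<close> by (intro mult_mono powr_mono2') auto
  then show ?thesis using xy y by (simp add: powr_diff powr_minus_divide)
qed

lemma weighted_neg_powr_antimono:
  assumes "concave_on {0..} \<Phi>" "\<And>u. 0 \<le> u \<Longrightarrow> 0 \<le> \<Phi> u" "1 \<le> a" and uv: "0 < u" "u \<le> v"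
  shows "weighted_neg_powr \<Phi> v a \<le> weighted_neg_powr \<Phi> u a"
proof (cases v)
  case (real y)
  then obtain x where x: "u = ennreal x" "0 < x" "x \<le> y"
    using uv by (cases u) (auto simp: top_unique)
  show ?thesis
    using real x concave_weighted_powr_antimono[OF assms(1-3) x(2,3)] assms(2)[of x] assms(2)[of y]
    by (simp add: weighted_neg_powr_def neg_powr_def ennreal_mult[symmetric] ennreal_leI)
qed (simp add: weighted_neg_powr_def)

text \<open>After taking reciprocals and \<open>m\<close>-th roots this is convexity of
  \<open>z powr (a / m)\<close>, which holds because \<open>a / m \<ge> 1\<close>.\<close>

lemma power_mean_powr_le:
  assumes st: "0 < s" "0 < t" "s + t = 1" and xy: "0 < x" "0 < y" and m: "0 < m" "real m \<le> a"
  shows "power_mean s t m (x powr (- a)) (y powr (- a)) \<le> (s * x + t * y) powr (- a)"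
proof -
  have w: "0 < s * x + t * y" using st xy by (simp add: add_pos_pos)
  have "s = 1 - t" using st by simp
  then have "(s * x + t * y) powr (a / m) \<le> s * x powr (a / m) + t * y powr (a / m)"
    using convex_onD[OF powr_convex[of "a / m"], of t x y] st xy m by (simp add: \<open>s = 1 - t\<close>)
  then have "((s * x + t * y) powr (a / m)) ^ m \<le> (s * x powr (a / m) + t * y powr (a / m)) ^ m"
    by (intro power_mono) auto
  also have "((s * x + t * y) powr (a / m)) ^ m = (s * x + t * y) powr a"
    using m w powr_power[of "s * x + t * y" "a / real m" m] by simp
  finally have "(s * x + t * y) powr a \<le> (s * x powr (a / m) + t * y powr (a / m)) ^ m" .
  moreover have "power_mean s t m (x powr (- a)) (y powr (- a)) = 1 / (s * x powr (a / m) + t * y powr (a / m)) ^ m"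
    using m by (simp add: power_mean_def powr_powr)
  moreover have "0 < (s * x + t * y) powr a" using w by simp
  ultimately show ?thesis
    by (simp add: powr_minus_divide frac_le)
qed

text \<open>Concavity bounds the averaged \<open>\<Phi>\<close> and the power mean bounds the
  negative power, both at the point \<open>w\<close>; monotonicity then passes from \<open>w\<close>
  down to \<open>r\<close>.\<close>

lemma weighted_neg_powr_ge_power_mean:
  assumes conc: "concave_on {0..} \<Phi>" and nonneg: "\<And>u. 0 \<le> u \<Longrightarrow> 0 \<le> \<Phi> u"
    and st: "0 < s" "0 < t" "s + t = 1" and m: "0 < m" "real m \<le> a"
    and pos: "0 < p" "0 < q" "0 < r" and le: "r \<le> ennreal s * p + ennreal t * q"
    and u: "neg_powr p a = ennreal u" "0 < u" and v: "neg_powr q a = ennreal v" "0 < v"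
  shows "(ennreal s * ennreal (\<Phi> (enn2real p)) + ennreal t * ennreal (\<Phi> (enn2real q)))
      * ennreal (power_mean s t m u v) \<le> weighted_neg_powr \<Phi> r a"
proof -
  \<comment> \<open>A positive \<open>u\<close> forces \<open>p\<close> to be finite, since
    \<open>neg_powr\<close> is 0 at infinity.\<close>
  obtain x where x: "p = ennreal x" "0 < x" "u = x powr (- a)"
    using u pos by (cases p) (auto simp: neg_powr_def)
  obtain y where y: "q = ennreal y" "0 < y" "v = y powr (- a)"
    using v pos by (cases q) (auto simp: neg_powr_def)
  define w where "w = s * x + t * y"
  have w: "0 < w" "ennreal s * p + ennreal t * q = ennreal w"
    using st x y by (simp_all add: w_def add_pos_pos ennreal_mult ennreal_plus)
  have "s = 1 - t" using st by simp
  then have "s * \<Phi> x + t * \<Phi> y \<le> \<Phi> w"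
    using concave_onD[OF conc, of t x y] st x y by (simp add: w_def \<open>s = 1 - t\<close>)
  moreover have "power_mean s t m u v \<le> w powr (- a)"
    unfolding x y w_def using st m x y by (intro power_mean_powr_le)
  ultimately have "(s * \<Phi> x + t * \<Phi> y) * power_mean s t m u v \<le> \<Phi> w * w powr (- a)"
    using w nonneg[of w] power_mean_pos[OF st(1,2) u(2) v(2), of m] by (intro mult_mono) auto
  then have "ennreal ((s * \<Phi> x + t * \<Phi> y) * power_mean s t m u v) \<le> ennreal (\<Phi> w * w powr (- a))"
    by (rule ennreal_leI)
  also have "ennreal (\<Phi> w * w powr (- a)) = weighted_neg_powr \<Phi> (ennreal w) a"
    using w nonneg[of w] by (simp add: weighted_neg_powr_def neg_powr_def ennreal_mult)
  also have "\<dots> \<le> weighted_neg_powr \<Phi> r a"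
    using le m by (intro weighted_neg_powr_antimono conc nonneg pos) (auto simp: w(2))
  finally show ?thesis
    using x y st nonneg[of x] nonneg[of y] power_mean_pos[OF st(1,2) u(2) v(2), of m]
    by (simp add: ennreal_mult ennreal_plus)
qed

section \<open>Coordinates, measurability and the inequality in n dimensions\<close>

lemma nn_integral_lborel_PiM_Basis:
  fixes F :: "'a::euclidean_space \<Rightarrow> ennreal"
  assumes "F \<in> borel_measurable borel"
  shows "(\<integral>\<^sup>+x. F x \<partial>lborel) = (\<integral>\<^sup>+y. F (\<Sum>b\<in>Basis. y b *\<^sub>R b) \<partial>(\<Pi>\<^sub>M b\<in>Basis. lborel))"
  using assms by (subst lborel_eq, subst nn_integral_distr) auto

text \<open>Precomposition with \<open>max 0\<close> extends \<open>\<Phi>\<close> continuously to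
  the whole line and changes nothing on the nonnegative values of \<open>enn2real\<close>.\<close>

lemma borel_measurable_compose_enn2real:
  assumes "continuous_on {0..} \<Phi>" and [measurable]: "G \<in> borel_measurable M"
  shows "(\<lambda>x. \<Phi> (enn2real (G x)) :: real) \<in> borel_measurable M"
proof -
  have "continuous_on UNIV (\<lambda>u. \<Phi> (max 0 u))"
    by (rule continuous_on_compose2[OF assms(1)]) (auto intro: continuous_on_max continuous_on_const continuous_on_id)
  then have "(\<lambda>u. \<Phi> (max 0 u)) \<in> borel_measurable borel"
    by (rule borel_measurable_continuous_onI)
  from measurable_compose[OF _ this, of "\<lambda>x. enn2real (G x)" M] show ?thesis by simp
qed

lemma borel_measurable_neg_powr [measurable]:
  "(\<lambda>u. neg_powr u a) \<in> borel_measurable borel"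
  unfolding neg_powr_def by measurable

theorem theorem6:
  fixes a s t :: real
    and \<Phi> :: "real \<Rightarrow> real"
    and g W H :: "real ^ 'n \<Rightarrow> ennreal"
  assumes "a \<ge> real CARD('n)"
    and "CARD('n) = 1 \<Longrightarrow> a > 1"
    and "\<And>u. u \<ge> 0 \<Longrightarrow> \<Phi> u \<ge> 0"
    and "C1_within {0..} \<Phi>"
    and "concave_on {0..} \<Phi>"
    and "g \<in> borel_measurable borel" "W \<in> borel_measurable borel" "H \<in> borel_measurable borel"
    and "\<And>x. g x > 0" "\<And>x. W x > 0" "\<And>x. H x > 0"
    and "t \<in> {0..1}" "s = 1 - t"
    and "\<And>x y. H (s *\<^sub>R x + t *\<^sub>R y) \<le> ennreal s * g x + ennreal t * W y"
    and "(\<integral>\<^sup>+ x. neg_powr (W x) a \<partial>lborel) = 1"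
    and "(\<integral>\<^sup>+ x. neg_powr (g x) a \<partial>lborel) = 1"
  shows "(\<integral>\<^sup>+ x. weighted_neg_powr \<Phi> (H x) a \<partial>lborel)
           \<ge> ennreal s * (\<integral>\<^sup>+ x. weighted_neg_powr \<Phi> (g x) a \<partial>lborel)
             + ennreal t * (\<integral>\<^sup>+ x. weighted_neg_powr \<Phi> (W x) a \<partial>lborel)"
proof -
  note nonneg = assms(3) and conc = assms(5) and le = assms(14)
  note [measurable] = assms(6-8)
  have "1 \<le> CARD('n)" by (simp add: Suc_leI)
  with assms(1) have a1: "1 \<le> a" by linarith
  \<comment> \<open>The quantile argument needs both weights positive. At the endpoints the
    hypothesis reads \<open>H \<le> g\<close> or \<open>H \<le> W\<close>, as
    \<open>0 * top = 0\<close> in \<open>ennreal\<close>, and monotonicity suffices.\<close>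
  consider "t = 0" "s = 1" | "t = 1" "s = 0" | "0 < s" "0 < t" "s + t = 1"
    using assms(12,13) by fastforce
  then show ?thesis
  proof cases
    case 1
    have "weighted_neg_powr \<Phi> (g x) a \<le> weighted_neg_powr \<Phi> (H x) a" for x
      using le[of x 0] 1 assms(11)[of x] by (intro weighted_neg_powr_antimono conc nonneg a1) auto
    then show ?thesis using 1 by (auto intro!: nn_integral_mono)
  next
    case 2
    have "weighted_neg_powr \<Phi> (W x) a \<le> weighted_neg_powr \<Phi> (H x) a" for x
      using le[of 0 x] 2 assms(11)[of x] by (intro weighted_neg_powr_antimono conc nonneg a1) auto
    then show ?thesis using 2 by (auto intro!: nn_integral_mono)
  next
    case st: 3
    obtain \<Phi>' where "\<And>u. u \<in> {0..} \<Longrightarrow> (\<Phi> has_real_derivative \<Phi>' u) (at u within {0..})"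
      using assms(4) unfolding C1_within_def by blast
    then have "continuous_on {0..} \<Phi>"
      by (rule DERIV_continuous_on)
    note [measurable] = borel_measurable_compose_enn2real[OF this]
    \<comment> \<open>No case split at infinity remains because \<open>neg_powr\<close> already
      vanishes there. The integrand thus factors into a weight \<open>\<phi>\<close> and a density
      \<open>f\<close>.\<close>
    have weighted: "weighted_neg_powr \<Phi> u a = ennreal (\<Phi> (enn2real u)) * neg_powr u a" for u
      by (simp add: weighted_neg_powr_def neg_powr_def)
    define e :: "(real ^ 'n \<Rightarrow> real) \<Rightarrow> real ^ 'n" where "e y = (\<Sum>b\<in>Basis. y b *\<^sub>R b)" for y
    have [measurable]: "e \<in> borel_measurable (\<Pi>\<^sub>M b\<in>Basis. lborel)"
      unfolding e_def by measurable
    have e_comb: "e (\<lambda>i. s * x i + t * y i) = s *\<^sub>R e x + t *\<^sub>R e y" for x y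
      by (simp add: e_def scaleR_sum_right sum.distrib scaleR_add_left)
    note tr = nn_integral_lborel_PiM_Basis[where 'a="real ^ 'n", folded e_def]
    have card: "card (Basis :: (real ^ 'n) set) = CARD('n)" by simp
    have "ennreal s * (\<integral>\<^sup>+y. ennreal (\<Phi> (enn2real (g (e y)))) * neg_powr (g (e y)) a \<partial>(\<Pi>\<^sub>M b\<in>Basis. lborel))
        + ennreal t * (\<integral>\<^sup>+y. ennreal (\<Phi> (enn2real (W (e y)))) * neg_powr (W (e y)) a \<partial>(\<Pi>\<^sub>M b\<in>Basis. lborel))
      \<le> (\<integral>\<^sup>+y. weighted_neg_powr \<Phi> (H (e y)) a \<partial>(\<Pi>\<^sub>M b\<in>Basis. lborel))"
    proof (rule nn_integral_ge_power_mean_PiM[OF finite_Basis st])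
      show "(\<integral>\<^sup>+y. neg_powr (g (e y)) a \<partial>(\<Pi>\<^sub>M b\<in>Basis. lborel)) = 1"
        "(\<integral>\<^sup>+y. neg_powr (W (e y)) a \<partial>(\<Pi>\<^sub>M b\<in>Basis. lborel)) = 1"
        using assms(15,16) by (simp_all add: tr)
    next
      fix x y u v
      assume "neg_powr (g (e x)) a = ennreal u" "neg_powr (W (e y)) a = ennreal v" "0 < u" "0 < v"
      then show "(ennreal s * ennreal (\<Phi> (enn2real (g (e x)))) + ennreal t * ennreal (\<Phi> (enn2real (W (e y)))))
          * ennreal (power_mean s t (card (Basis :: (real ^ 'n) set)) u v)
        \<le> weighted_neg_powr \<Phi> (H (e (\<lambda>i. s * x i + t * y i))) a"
        unfolding e_comb card
        using assms(1,9-11) le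
        by (intro weighted_neg_powr_ge_power_mean conc nonneg st) auto
    qed (simp_all add: weighted)
    then show ?thesis
      by (simp add: tr weighted)
  qed
qed

end
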